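(* There exists a function $f\in\bigcap_{p\ge1}HB^p_{(-\infty,\infty)}$ such that, for all $H>0$, every function $g$ equivalent to $f$ in any space $HB^p_{[-H,H]}$, $p\ge1$, does not belong to $HW^1_{[-H,H]}$.
   Context: For real $\alpha\le\beta$ let $\Pi_{[\alpha,\beta]}=\{z=x+iy\in\mathbf C:\ x\in\mathbf R,\ \alpha\le y\le\beta\}$. A finite exponential sum on $\Pi_{[\alpha,\beta]}$ is a function $\sum_{n=1}^N c_n(y)e^{i\lambda_n x}$ with $\lambda_n\in\mathbf R$ and $c_n$ continuous complex-valued functions on $[\alpha,\beta]$. For $p\ge1$ and complex-valued functions $g,h$ on $\Pi_{[\alpha,\beta]}$ that are measurable and such that $|g(x+iy)|^p$, $|h(x+iy)|^p$ are locally integrable in $x$ for each fixed $y$, the Weyl and Besicovitch distances of order $p$ are $$d^{W^p}_{[\alpha,\beta]}(g,h)=\limsup_{T\to\infty}\ \sup_{z\in\Pi_{[\alpha,\beta]}}\left(\frac1{2T}\int_{-T}^{T}|g(z+t)-h(z+t)|^p\,dt\right)^{1/p},$$ $$d^{B^p}_{[\alpha,\beta]}(g,h)=\limsup_{T\to\infty}\ \sup_{\alpha\le y\le\beta}\left(\frac1{2T}\int_{-T}^{T}|g(t+iy)-h(t+iy)|^p\,dt\right)^{1/p}.$$ $W^p_{[\alpha,\beta]}$ (respectively $B^p_{[\alpha,\beta]}$) is the closure of the set of finite exponential sums in the corresponding (pseudo)metric: $f$ belongs to it if for every $\varepsilon>0$ there is a finite exponential sum $Q$ with $d^{W^p}_{[\alpha,\beta]}(f,Q)<\varepsilon$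 (respectively $d^{B^p}_{[\alpha,\beta]}(f,Q)<\varepsilon$). The prefix $H$ denotes spaces of holomorphic functions. $HB^p_{(-\infty,\infty)}$ is the set of entire functions on $\mathbf C$ whose restriction to $\Pi_{[\alpha,\beta]}$ belongs to $B^p_{[\alpha,\beta]}$ for all real $\alpha<\beta$. For $H>0$, $HB^p_{[-H,H]}$ (respectively $HW^1_{[-H,H]}$) is the set of functions on $\Pi_{[-H,H]}$ that belong to $B^p_{[-H,H]}$ (respectively $W^1_{[-H,H]}$) and are holomorphic in the interior $\{|y|<H\}$ of the strip. A function $g$ is equivalent to $f$ in $HB^p_{[-H,H]}$ if $g\in HB^p_{[-H,H]}$ and $d^{B^p}_{[-H,H]}(f,g)=0$. *)

theory Defs
  imports "HOL-Analysis.Analysis"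
begin

definition strip :: "real \<Rightarrow> real \<Rightarrow> complex set" where
  "strip \<alpha> \<beta> = {z. \<alpha> \<le> Im z \<and> Im z \<le> \<beta>}"

(* Functions on a strip are represented by total functions on the complex plane; every
   notion below depends only on the values on the closed strip in question. *)

definition finite_exp_sum :: "real \<Rightarrow> real \<Rightarrow> (complex \<Rightarrow> complex) \<Rightarrow> bool" where
  "finite_exp_sum \<alpha> \<beta> Q \<longleftrightarrow>
     (\<exists>(N::nat) (c :: nat \<Rightarrow> real \<Rightarrow> complex) (l :: nat \<Rightarrow> real).
        (\<forall>n\<in>{1..N}. continuous_on {\<alpha>..\<beta>} (c n)) \<and>
        (\<forall>z\<in>strip \<alpha> \<beta>. Q z = (\<Sum>n=1..N. c n (Im z) * exp (\<i> * of_real (l n * Re z)))))"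

(* The functions between which the distances of order p are taken.  The second condition makes
   t \<mapsto> |g - h|^p measurable on every horizontal line, which Lebesgue measurability in the
   plane does not give on a null set of lines. *)

definition admissible :: "real \<Rightarrow> real \<Rightarrow> real \<Rightarrow> (complex \<Rightarrow> complex) \<Rightarrow> bool" where
  "admissible p \<alpha> \<beta> g \<longleftrightarrow>
     g \<in> borel_measurable (lebesgue_on (strip \<alpha> \<beta>)) \<and>
     (\<forall>y\<in>{\<alpha>..\<beta>}. (\<lambda>x::real. g (Complex x y)) \<in> borel_measurable lebesgue) \<and>
     (\<forall>y\<in>{\<alpha>..\<beta>}. \<forall>a b :: real.
        set_integrable lebesgue {a..b} (\<lambda>x. norm (g (Complex x y)) powr p))"

(* The distances take values in the extended reals because the suprema may be infinite.  The
   integrals are finite for admissible g and h. *)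

definition Weyl_dist ::
    "real \<Rightarrow> real \<Rightarrow> real \<Rightarrow> (complex \<Rightarrow> complex) \<Rightarrow> (complex \<Rightarrow> complex) \<Rightarrow> ereal" where
  "Weyl_dist p \<alpha> \<beta> g h =
     Limsup at_top (\<lambda>T::real. SUP z\<in>strip \<alpha> \<beta>.
       ereal ((1 / (2 * T) *
         (LINT t:{-T..T}|lebesgue. norm (g (z + of_real t) - h (z + of_real t)) powr p))
           powr (1 / p)))"

definition Besicovitch_dist ::
    "real \<Rightarrow> real \<Rightarrow> real \<Rightarrow> (complex \<Rightarrow> complex) \<Rightarrow> (complex \<Rightarrow> complex) \<Rightarrow> ereal" where
  "Besicovitch_dist p \<alpha> \<beta> g h =
     Limsup at_top (\<lambda>T::real. SUP y\<in>{\<alpha>..\<beta>}.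
       ereal ((1 / (2 * T) *
         (LINT t:{-T..T}|lebesgue. norm (g (Complex t y) - h (Complex t y)) powr p))
           powr (1 / p)))"

definition W_space :: "real \<Rightarrow> real \<Rightarrow> real \<Rightarrow> (complex \<Rightarrow> complex) set" where
  "W_space p \<alpha> \<beta> = {f. admissible p \<alpha> \<beta> f \<and>
     (\<forall>\<epsilon>>0. \<exists>Q. finite_exp_sum \<alpha> \<beta> Q \<and> Weyl_dist p \<alpha> \<beta> f Q < ereal \<epsilon>)}"

definition B_space :: "real \<Rightarrow> real \<Rightarrow> real \<Rightarrow> (complex \<Rightarrow> complex) set" where
  "B_space p \<alpha> \<beta> = {f. admissible p \<alpha> \<beta> f \<and>
     (\<forall>\<epsilon>>0. \<exists>Q. finite_exp_sum \<alpha> \<beta> Q \<and> Besicovitch_dist p \<alpha> \<beta> f Q < ereal \<epsilon>)}"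

definition HW_space :: "real \<Rightarrow> real \<Rightarrow> (complex \<Rightarrow> complex) set" where
  "HW_space p H = {f. f \<in> W_space p (-H) H \<and> f holomorphic_on {z. \<bar>Im z\<bar> < H}}"

definition HB_space :: "real \<Rightarrow> real \<Rightarrow> (complex \<Rightarrow> complex) set" where
  "HB_space p H = {f. f \<in> B_space p (-H) H \<and> f holomorphic_on {z. \<bar>Im z\<bar> < H}}"

definition HB_entire :: "real \<Rightarrow> (complex \<Rightarrow> complex) set" where
  "HB_entire p = {f. f holomorphic_on UNIV \<and> (\<forall>\<alpha> \<beta>. \<alpha> < \<beta> \<longrightarrow> f \<in> B_space p \<alpha> \<beta>)}"

definition equivalent_HB ::
    "real \<Rightarrow> real \<Rightarrow> (complex \<Rightarrow> complex) \<Rightarrow> (complex \<Rightarrow> complex) \<Rightarrow> bool" where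
  "equivalent_HB p H f g \<longleftrightarrow> g \<in> HB_space p H \<and> Besicovitch_dist p (-H) H f g = 0"

end

theory Submission
  imports Defs "HOL-Complex_Analysis.Complex_Analysis"
begin

text \<open>The witness is \<open>f = (\<Sum>n. 2^n (sin (z / q))^(2 q^2))\<close> with \<open>q = 2^(n^2)\<close>. On the real axis
  the \<open>n\<close>-th summand is nonnegative and consists of spikes of width about \<open>1\<close> and height \<open>2^n\<close>,
  one per period \<open>\<pi> q\<close>. The spikes are so sparse that their means of every order \<open>p\<close> are summable,
  uniformly in \<open>T > 0\<close> and locally uniformly in \<open>y\<close>, so the partial sums, which are exponential sums,
  converge to \<open>f\<close> in every Besicovitch distance. A function in \<open>W^1\<close> has uniformly bounded means
  over all windows of some fixed length, hence differs from \<open>f\<close> by a fixed amount at every spike of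
  a sufficiently high summand. These spikes have positive density, so the Besicovitch distance is
  positive.\<close>

section \<open>Elementary bounds for sine and cosine\<close>

lemma cos_ge_one_minus_square: "1 - x\<^sup>2 / 2 \<le> cos (x::real)"
proof -
  have "(sin (x/2))\<^sup>2 \<le> (x/2)\<^sup>2"
    using abs_sin_x_le_abs_x[of "x/2"] by (metis abs_le_square_iff)
  then show ?thesis
    using cos_double_sin[of "x/2"] by (simp add: power_divide)
qed

text \<open>A crude Jordan inequality: \<open>sin x - x / 4\<close> increases on [0, pi/3], and
  beyond that \<open>sin x\<close> is at least 1/2 while \<open>x / 4\<close> stays below it. Only
  the quadratic order in \<open>v\<close> matters later, not the constant.\<close>

lemma sin_squared_ge:
  fixes v :: real
  assumes "\<bar>v\<bar> \<le> pi / 2"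
  shows "v\<^sup>2 / 16 \<le> (sin v)\<^sup>2"
proof -
  have ge: "x / 4 \<le> sin x" if "0 \<le> x" "x \<le> pi / 2" for x :: real
  proof (cases "x \<le> pi / 3")
    case True
    have "sin 0 - 0 / 4 \<le> sin x - x / 4"
    proof (rule DERIV_nonneg_imp_nondecreasing[OF that(1)])
      fix y assume y: "0 \<le> y" "y \<le> x"
      have "cos (pi / 3) \<le> cos y"
        using y True by (intro cos_monotone_0_pi_le) auto
      then have "0 \<le> cos y - 1 / 4"
        by (simp add: cos_60)
      moreover have "((\<lambda>x. sin x - x / 4) has_real_derivative cos y - 1 / 4) (at y)"
        by (auto intro!: derivative_eq_intros)
      ultimately show "\<exists>d. ((\<lambda>x. sin x - x / 4) has_real_derivative d) (at y) \<and> 0 \<le> d"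
        by blast
    qed
    then show ?thesis by simp
  next
    case False
    have "sin (pi / 6) \<le> sin x"
      using that False by (intro sin_monotone_2pi_le) auto
    moreover have "x / 4 \<le> 1 / 2"
      using that pi_less_4 by simp
    ultimately show ?thesis by (simp add: sin_30)
  qed
  have "\<bar>v\<bar> / 4 \<le> \<bar>sin v\<bar>"
    using ge[of "\<bar>v\<bar>"] assms by (auto simp: abs_if split: if_splits)
  then have "(\<bar>v\<bar> / 4)\<^sup>2 \<le> \<bar>sin v\<bar>\<^sup>2"
    by (intro power_mono) auto
  then show ?thesis by (simp add: power_divide)
qed

text \<open>The half-odd multiples of \<open>pi\<close> are the real points where \<open>sin\<close>
  has modulus 1, that is, the spike centres after rescaling by \<open>q\<close>; \<open>v\<close>
  measures the deviation from such a centre.\<close>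

lemma sin_half_odd_pi_squared: "(sin (v + (real j + 1/2) * pi))\<^sup>2 = (cos v)\<^sup>2"
proof -
  have "sin (v + (real j + 1/2) * pi) = sin ((v + real j * pi) + pi / 2)"
    by (simp add: algebra_simps)
  also have "\<dots> = cos (v + real j * pi)"
    by (simp only: sin_add) simp
  also have "\<dots> = (-1) ^ j * cos v"
    by (simp add: cos_add mult.commute[of "real j" pi])
  finally show ?thesis
    by (simp add: power_mult_distrib flip: power_mult)
qed

lemma norm_sin_squared_le:
  assumes "\<bar>Im z\<bar> \<le> 1 / 2"
  shows "(norm (sin z))\<^sup>2 \<le> (sin (Re z))\<^sup>2 + 2 * (Im z)\<^sup>2"
proof -
  \<comment> \<open>This bounds 2 cosh \<open>v\<close>: the linear terms of the bounds for
    \<open>exp v\<close> and for its inverse cancel. The hypothesis on \<open>Im z\<close> keeps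
    \<open>2 * Im z\<close> in the range where it applies, and evenness handles the negative
    sign.\<close>
  have cosh: "exp v + inverse (exp v) \<le> 2 + 2 * v\<^sup>2" if "0 \<le> v" "v \<le> 1" for v :: real
  proof -
    have "exp v \<le> 1 + v + v\<^sup>2"
      using that by (intro exp_bound)
    moreover have "inverse (exp v) \<le> inverse (1 + v)"
      using that exp_ge_add_one_self[of v] by (intro le_imp_inverse_le) auto
    moreover have "inverse (1 + v) \<le> 1 - v + v\<^sup>2"
    proof -
      have "1 \<le> (1 - v + v\<^sup>2) * (1 + v)"
        using that by (simp add: algebra_simps power2_eq_square)
      then show ?thesis
        using that by (simp add: inverse_eq_divide pos_divide_le_eq)
    qed
    ultimately show ?thesis by linarith
  qed
  have "exp (2 * Im z) + inverse (exp (2 * Im z)) \<le> 2 + 2 * (2 * Im z)\<^sup>2"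
    using cosh[of "2 * Im z"] cosh[of "- (2 * Im z)"] assms
    by (cases "Im z \<ge> 0") (auto simp: exp_minus add.commute)
  then show ?thesis
    unfolding norm_sin_squared using cos_double_sin[of "Re z"] power_mult_distrib[of 2 "Im z" 2]
    by simp
qed

text \<open>At \<open>z / q\<close> the squared modulus of the sine is at most 1 + s <= exp s with s
  = \<open>2 * (Im z / q)^2 - (cos (Re z / q))^2\<close>. Raising to the power \<open>q^2\<close>
  cancels the scale in the first term, so the growth in \<open>Im z\<close> is the same for all
  \<open>q\<close>. Near a zero of the cosine, \<open>q * cos (Re z / q)\<close> is up to sign about
  the distance of \<open>Re z\<close> to that zero, so the spikes keep width about 1.\<close>

lemma norm_sin_power_le:
  fixes q :: nat
  assumes "0 < q" "2 * \<bar>Im z\<bar> \<le> q"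
  shows "norm (sin (z / of_nat q)) ^ (2 * q\<^sup>2) \<le> exp (2 * (Im z)\<^sup>2) * exp (- (q * cos (Re z / q))\<^sup>2)"
proof -
  let ?w = "z / of_nat q"
  have "(norm (sin ?w))\<^sup>2 \<le> (sin (Re ?w))\<^sup>2 + 2 * (Im ?w)\<^sup>2"
    using assms by (intro norm_sin_squared_le) (simp add: field_simps)
  also have "\<dots> = 1 + (2 * (Im z / q)\<^sup>2 - (cos (Re z / q))\<^sup>2)"
    by (simp add: sin_squared_eq)
  also have "\<dots> \<le> exp (2 * (Im z / q)\<^sup>2 - (cos (Re z / q))\<^sup>2)"
    by (rule exp_ge_add_one_self)
  finally have "((norm (sin ?w))\<^sup>2) ^ q\<^sup>2 \<le> exp (2 * (Im z / q)\<^sup>2 - (cos (Re z / q))\<^sup>2) ^ q\<^sup>2"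
    by (intro power_mono) auto
  also have "\<dots> = exp (2 * (Im z)\<^sup>2 - (q * cos (Re z / q))\<^sup>2)"
    using assms(1) by (simp add: exp_of_nat_mult[symmetric] power_divide power_mult_distrib algebra_simps)
  finally show ?thesis
    by (simp add: power_mult exp_add[symmetric])
qed

section \<open>Means of a periodic train of spikes\<close>

lemma integral_cells:
  fixes h :: "real \<Rightarrow> real"
  assumes "\<And>a b. h integrable_on {a..b}" "0 \<le> P"
  shows "integral {0..real k * P} h = (\<Sum>j<k. integral {real j * P..(real j + 1) * P} h)"
proof (induction k)
  case (Suc k)
  have "integral {0..real k * P} h + integral {real k * P..real (Suc k) * P} h
      = integral {0..real (Suc k) * P} h"
    using assms by (intro Henstock_Kurzweil_Integration.integral_combine) (auto intro: mult_right_mono)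
  then show ?case
    using Suc by (simp add: add.commute)
qed auto

text \<open>Each cell of length \<open>pi * q\<close> holds one spike, at its midpoint
  \<open>c\<close>. There the spike lies below the Cauchy profile
  \<open>inverse (1 + ((t - c) / 4)^2)\<close>, whose integral over the whole line is
  \<open>4 * pi\<close> for every \<open>q\<close>.\<close>

lemma integral_spike_cell_le:
  fixes q :: nat
  assumes "0 < q"
  shows "integral {real j * (pi * q)..(real j + 1) * (pi * q)} (\<lambda>t. exp (- (q * cos (t / q))\<^sup>2)) \<le> 4 * pi"
proof -
  define c where "c = (real j + 1 / 2) * (pi * q)"
  let ?a = "real j * (pi * q)" and ?b = "(real j + 1) * (pi * q)"
  have ab: "?a \<le> ?b"
    using assms by (intro mult_right_mono) auto
  have bound: "exp (- (q * cos (t / q))\<^sup>2) \<le> inverse (1 + ((t - c) / 4)\<^sup>2)" if t: "t \<in> {?a..?b}" for t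
  proof -
    define v where "v = (t - c) / q"
    \<comment> \<open>The shift by \<open>pi / 2\<close> turns the half-odd multiple of
      \<open>pi\<close> at the centre into an integer multiple, so the squared cosine becomes the
      squared sine of the deviation \<open>v\<close>.\<close>
    have tv: "t / q + pi / 2 = v + real (Suc j) * pi"
      using assms by (simp add: v_def c_def field_simps)
    have "(cos (t / q))\<^sup>2 = (sin (t / q + pi / 2))\<^sup>2"
      by (simp add: sin_add)
    also have "\<dots> = (sin v)\<^sup>2"
      unfolding tv sin_add
      by (simp add: mult.commute[of "1 + real j" pi] mult.commute[of "real (Suc j)" pi]
          power_mult_distrib flip: power_mult of_nat_Suc del: power_Suc of_nat_Suc)
    finally have cs: "(cos (t / q))\<^sup>2 = (sin v)\<^sup>2" .
    have "\<bar>v\<bar> \<le> pi / 2"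
      using t assms by (simp add: v_def c_def abs_le_iff field_simps)
    then have "v\<^sup>2 / 16 \<le> (cos (t / q))\<^sup>2"
      using cs sin_squared_ge by simp
    then have "q\<^sup>2 * (v\<^sup>2 / 16) \<le> q\<^sup>2 * (cos (t / q))\<^sup>2"
      by (intro mult_left_mono) auto
    then have le: "((t - c) / 4)\<^sup>2 \<le> (q * cos (t / q))\<^sup>2"
      using assms by (simp add: v_def power_divide power_mult_distrib)
    have "1 + ((t - c) / 4)\<^sup>2 \<le> exp ((q * cos (t / q))\<^sup>2)"
      using exp_ge_add_one_self[of "(q * cos (t / q))\<^sup>2"] le by linarith
    then show ?thesis
      unfolding exp_minus by (intro le_imp_inverse_le) (auto intro: add_pos_nonneg)
  qed
  have pos: "1 + ((t - c) / 4)\<^sup>2 \<noteq> 0" for t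
    by (metis add_pos_nonneg less_numeral_extra(1,3) zero_le_power2)
  have der: "((\<lambda>t. 4 * arctan ((t - c) / 4)) has_vector_derivative inverse (1 + ((t - c) / 4)\<^sup>2))
       (at t within {?a..?b})" for t
    unfolding has_real_derivative_iff_has_vector_derivative[symmetric]
    using pos[of t] by (auto intro!: derivative_eq_intros)
  have int: "((\<lambda>t. inverse (1 + ((t - c) / 4)\<^sup>2)) has_integral
       4 * arctan ((?b - c) / 4) - 4 * arctan ((?a - c) / 4)) {?a..?b}"
    using ab der by (intro fundamental_theorem_of_calculus) auto
  have "integral {?a..?b} (\<lambda>t. exp (- (q * cos (t / q))\<^sup>2))
      \<le> integral {?a..?b} (\<lambda>t. inverse (1 + ((t - c) / 4)\<^sup>2))"
    using bound assms pos
    by (intro integral_le integrable_continuous_real continuous_intros) auto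
  also have "\<dots> = 4 * arctan ((?b - c) / 4) - 4 * arctan ((?a - c) / 4)"
    using int by (rule integral_unique)
  also have "\<dots> \<le> 4 * pi"
    using arctan_ubound[of "(?b - c) / 4"] arctan_lbound[of "(?a - c) / 4"] by simp
  finally show ?thesis .
qed

text \<open>The spike centres nearest to the origin are at distance \<open>pi * q / 2 > q\<close>.
  In this central window the cosine is at least 1/2, and exp(-s) <= 1/s with s at least
  \<open>q^2 / 4\<close> gives the bound.\<close>

lemma exp_neg_cos_le:
  fixes q :: nat and t :: real
  assumes "0 < q" "\<bar>t\<bar> \<le> q"
  shows "exp (- (q * cos (t / q))\<^sup>2) \<le> 4 / q\<^sup>2"
proof -
  have "(t / q)\<^sup>2 \<le> 1"
    using assms by (simp add: abs_square_le_1)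
  then have "1 / 2 \<le> cos (t / q)"
    using cos_ge_one_minus_square[of "t / q"] by linarith
  then have "(q * (1 / 2))\<^sup>2 \<le> (q * cos (t / q))\<^sup>2"
    by (intro power_mono mult_left_mono) auto
  moreover have "(q * (1 / 2))\<^sup>2 = (real q)\<^sup>2 / 4"
    by (simp add: power_divide)
  ultimately have "q\<^sup>2 / 4 \<le> exp ((q * cos (t / q))\<^sup>2)"
    using exp_ge_add_one_self[of "(q * cos (t / q))\<^sup>2"] unfolding of_nat_power by linarith
  then have "inverse (exp ((q * cos (t / q))\<^sup>2)) \<le> inverse (q\<^sup>2 / 4)"
    using assms by (intro le_imp_inverse_le) auto
  then show ?thesis by (simp add: exp_minus)
qed

text \<open>The mean must be small for every window, including those shorter than the period, since
  all summands are later compared on the same \<open>T\<close>. For \<open>T \<le> q\<close> the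
  window avoids the spike centres and \<open>4 / q^2\<close> suffices. For larger \<open>T\<close>,
  at most \<open>T / (pi * q) + 1\<close> cells cover half of the window; the extra cell costs
  \<open>4 * pi \<le> 16\<close>, which \<open>T / q > 1\<close> absorbs, whence 20 = 4 +
  16.\<close>

lemma integral_spikes_le:
  fixes q :: nat
  assumes "0 < q" "0 \<le> T"
  shows "integral {-T..T} (\<lambda>t. exp (- (q * cos (t / q))\<^sup>2)) \<le> 2 * T * (20 / q)"
proof -
  define h where "h = (\<lambda>t. exp (- (real q * cos (t / q))\<^sup>2))"
  have int: "h integrable_on {a..b}" for a b
    unfolding h_def using assms by (intro integrable_continuous_real continuous_intros) auto
  have half: "integral {0..T} h \<le> 20 * T / q"
  proof (cases "T \<le> q")
    case True
    have "integral {0..T} h \<le> integral {0..T} (\<lambda>t. 4 / (real q)\<^sup>2)"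
      unfolding h_def
      using int[unfolded h_def] exp_neg_cos_le[OF assms(1)] True by (intro integral_le) auto
    also have "\<dots> = T * (4 / (real q)\<^sup>2)"
      using assms by simp
    also have "\<dots> \<le> T * (20 / q)"
      using assms by (intro mult_left_mono) (auto simp: field_simps power2_eq_square)
    finally show ?thesis by (simp add: mult.commute)
  next
    case False
    define k where "k = nat \<lceil>T / (pi * q)\<rceil>"
    have k: "T \<le> real k * (pi * q)" "real k \<le> T / (pi * q) + 1"
    proof -
      have "T / (pi * q) \<le> real k" unfolding k_def by linarith
      then show "T \<le> real k * (pi * q)" using assms by (simp add: field_simps)
      have "0 \<le> T / (pi * q)" using assms by simp
      then show "real k \<le> T / (pi * q) + 1" unfolding k_def by linarith
    qed
    have "integral {0..T} h \<le> integral {0..real k * (pi * q)} h"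
      using int k by (intro integral_subset_le) (auto simp: h_def)
    also have "\<dots> = (\<Sum>j<k. integral {real j * (pi * q)..(real j + 1) * (pi * q)} h)"
      by (intro integral_cells int) auto
    also have "\<dots> \<le> (\<Sum>j<k. 4 * pi)"
      unfolding h_def using assms by (intro sum_mono integral_spike_cell_le)
    also have "\<dots> \<le> 4 * pi * (T / (pi * q) + 1)"
      using k(2) by simp
    also have "\<dots> = 4 * T / q + 4 * pi"
      using assms by (simp add: field_simps)
    also have "\<dots> \<le> 20 * T / q"
    proof -
      have "4 * pi \<le> 16 * 1" using pi_less_4 by simp
      also have "1 \<le> T / q" using False assms by (simp add: field_simps)
      finally have "4 * pi \<le> 16 * (T / q)" by simp
      then show ?thesis
        unfolding times_divide_eq_right[symmetric] by linarith
    qed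
    finally show ?thesis .
  qed
  have "integral {-T..0} h = integral {0..T} h"
    using Henstock_Kurzweil_Integration.integral_reflect_real[where a=0 and b=T and f=h] by (simp add: h_def)
  moreover have "integral {-T..0} h + integral {0..T} h = integral {-T..T} h"
    using int assms by (intro Henstock_Kurzweil_Integration.integral_combine) auto
  ultimately have "integral {-T..T} h \<le> 2 * (20 * T / q)"
    using half by linarith
  also have "\<dots> = 2 * T * (20 / q)" by simp
  finally show ?thesis by (simp only: h_def)
qed

section \<open>Closure properties of finite exponential sums\<close>

text \<open>Arbitrary finite index sets are convenient because sums and products of exponential sums
  are naturally indexed by disjoint unions and Cartesian products.\<close>

lemma finite_exp_sumI:
  assumes "finite A" "\<And>n. n \<in> A \<Longrightarrow> continuous_on {\<alpha>..\<beta>} (c n)"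
    and "\<And>z. z \<in> strip \<alpha> \<beta> \<Longrightarrow> Q z = (\<Sum>n\<in>A. c n (Im z) * exp (\<i> * of_real (l n * Re z)))"
  shows "finite_exp_sum \<alpha> \<beta> Q"
proof -
  obtain b where b: "bij_betw b {1..card A} A"
    using ex_bij_betw_nat_finite_1[OF assms(1)] by blast
  show ?thesis
    unfolding finite_exp_sum_def
  proof (intro exI conjI ballI)
    fix n assume "n \<in> {1..card A}"
    then show "continuous_on {\<alpha>..\<beta>} (c (b n))"
      using assms(2) bij_betwE[OF b] by blast
  next
    fix z assume "z \<in> strip \<alpha> \<beta>"
    then show "Q z = (\<Sum>n=1..card A. c (b n) (Im z) * exp (\<i> * of_real (l (b n) * Re z)))"
      using sum.reindex_bij_betw[OF b, of "\<lambda>n. c n (Im z) * exp (\<i> * of_real (l n * Re z))"] assms(3)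
      by simp
  qed
qed

lemma finite_exp_sum_const: "finite_exp_sum \<alpha> \<beta> (\<lambda>_. a)"
  by (rule finite_exp_sumI[where A="{()}" and c="\<lambda>_ _. a" and l="\<lambda>_. 0"]) auto

lemma finite_exp_sum_exp: "finite_exp_sum \<alpha> \<beta> (\<lambda>z. exp (\<i> * of_real a * z))"
proof (rule finite_exp_sumI[where A="{()}" and c="\<lambda>_ y. exp (- of_real (a * y))" and l="\<lambda>_. a"])
  show "exp (\<i> * of_real a * z) = (\<Sum>n\<in>{()}. exp (- of_real (a * Im z)) * exp (\<i> * of_real (a * Re z)))" for z
    by (simp add: exp_add[symmetric]) (simp add: complex_eq_iff Re_exp Im_exp)
qed (auto intro!: continuous_intros)

lemma finite_exp_sum_add:
  assumes "finite_exp_sum \<alpha> \<beta> P" "finite_exp_sum \<alpha> \<beta> Q"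
  shows "finite_exp_sum \<alpha> \<beta> (\<lambda>z. P z + Q z)"
proof -
  obtain N M :: nat and c d l m where
    P: "\<forall>n\<in>{1..N}. continuous_on {\<alpha>..\<beta>} (c n)"
       "\<forall>z\<in>strip \<alpha> \<beta>. P z = (\<Sum>n=1..N. c n (Im z) * exp (\<i> * of_real (l n * Re z)))" and
    Q: "\<forall>n\<in>{1..M}. continuous_on {\<alpha>..\<beta>} (d n)"
       "\<forall>z\<in>strip \<alpha> \<beta>. Q z = (\<Sum>n=1..M. d n (Im z) * exp (\<i> * of_real (m n * Re z)))"
    using assms unfolding finite_exp_sum_def by blast
  show ?thesis
    by (rule finite_exp_sumI[where A="{1..N} <+> {1..M}" and c="case_sum c d" and l="case_sum l m"])
       (use P Q in \<open>auto simp: sum.Plus\<close>)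
qed

lemma finite_exp_sum_mult:
  assumes "finite_exp_sum \<alpha> \<beta> P" "finite_exp_sum \<alpha> \<beta> Q"
  shows "finite_exp_sum \<alpha> \<beta> (\<lambda>z. P z * Q z)"
proof -
  obtain N M :: nat and c d l m where
    P: "\<forall>n\<in>{1..N}. continuous_on {\<alpha>..\<beta>} (c n)"
       "\<forall>z\<in>strip \<alpha> \<beta>. P z = (\<Sum>n=1..N. c n (Im z) * exp (\<i> * of_real (l n * Re z)))" and
    Q: "\<forall>n\<in>{1..M}. continuous_on {\<alpha>..\<beta>} (d n)"
       "\<forall>z\<in>strip \<alpha> \<beta>. Q z = (\<Sum>n=1..M. d n (Im z) * exp (\<i> * of_real (m n * Re z)))"
    using assms unfolding finite_exp_sum_def by blast
  show ?thesis
  proof (rule finite_exp_sumI[where A="{1..N} \<times> {1..M}" and c="\<lambda>(i, j) y. c i y * d j y"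
        and l="\<lambda>(i, j). l i + m j"])
    fix z assume "z \<in> strip \<alpha> \<beta>"
    then show "P z * Q z = (\<Sum>n\<in>{1..N} \<times> {1..M}. (case n of (i, j) \<Rightarrow> \<lambda>y. c i y * d j y) (Im z) *
        exp (\<i> * of_real ((case n of (i, j) \<Rightarrow> l i + m j) * Re z)))"
      using P(2) Q(2)
      by (simp add: sum_product sum.cartesian_product case_prod_unfold distrib_left distrib_right
          exp_add mult_ac)
  qed (use P(1) Q(1) in \<open>auto intro!: continuous_intros\<close>)
qed

lemma finite_exp_sum_power:
  "finite_exp_sum \<alpha> \<beta> P \<Longrightarrow> finite_exp_sum \<alpha> \<beta> (\<lambda>z. P z ^ k)"
  by (induction k) (auto intro: finite_exp_sum_const finite_exp_sum_mult)

lemma finite_exp_sum_sum: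
  "(\<And>i. i < k \<Longrightarrow> finite_exp_sum \<alpha> \<beta> (P i)) \<Longrightarrow> finite_exp_sum \<alpha> \<beta> (\<lambda>z. \<Sum>i<k. P i z)" for k :: nat
  by (induction k) (auto intro: finite_exp_sum_const finite_exp_sum_add)

lemma finite_exp_sum_sin: "finite_exp_sum \<alpha> \<beta> (\<lambda>z. sin (z / of_nat q))"
proof -
  \<comment> \<open>Euler's formula with the difference written as a sum with factor
    \<open>-1\<close>, the shape matched by the closure rules for sums and products.\<close>
  have "sin (z / of_nat q) = 1 / (2 * \<i>) * (exp (\<i> * of_real (1 / real q) * z) + (- 1) * exp (\<i> * of_real (- 1 / real q) * z))" for z
    by (simp add: sin_exp_eq field_simps)
  then show ?thesis
    by (simp only:) (intro finite_exp_sum_mult finite_exp_sum_add finite_exp_sum_const finite_exp_sum_exp)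
qed

text \<open>The frequencies are real, so on the real axis each summand has the constant modulus
  \<open>norm (c n 0)\<close>.\<close>

lemma finite_exp_sum_on_real_line:
  assumes "finite_exp_sum \<alpha> \<beta> Q" "\<alpha> \<le> 0" "0 \<le> \<beta>"
  shows "continuous_on UNIV (\<lambda>x::real. Q (Complex x 0))" "\<exists>B. \<forall>x. norm (Q (Complex x 0)) \<le> B"
proof -
  obtain N :: nat and c l where
    Q: "\<And>z. z\<in>strip \<alpha> \<beta> \<Longrightarrow> Q z = (\<Sum>n=1..N. c n (Im z) * exp (\<i> * of_real (l n * Re z)))"
    using assms unfolding finite_exp_sum_def by blast
  have eq: "Q (Complex x 0) = (\<Sum>n=1..N. c n 0 * exp (\<i> * of_real (l n * x)))" for x
    using Q[of "Complex x 0"] assms by (simp add: strip_def)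
  show "continuous_on UNIV (\<lambda>x::real. Q (Complex x 0))"
    unfolding eq by (intro continuous_intros)
  have "norm (Q (Complex x 0)) \<le> (\<Sum>n=1..N. norm (c n 0))" for x
    unfolding eq by (rule order_trans[OF norm_sum]) (simp add: norm_mult)
  then show "\<exists>B. \<forall>x. norm (Q (Complex x 0)) \<le> B" by blast
qed

section \<open>Integrability and integrals along horizontal lines\<close>

lemma continuous_Complex_line: "continuous_on S (\<lambda>x. Complex x y)"
  unfolding Complex_eq by (intro continuous_intros)

lemma continuous_norm_powr:
  fixes g :: "real \<Rightarrow> complex"
  assumes "continuous_on S g" "0 < p"
  shows "continuous_on S (\<lambda>x. norm (g x) powr p)"
  using assms by (intro continuous_on_powr' continuous_intros) auto

lemma admissible_continuous:
  assumes f: "continuous_on UNIV f" and p: "0 < p"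
  shows "admissible p \<alpha> \<beta> f"
  unfolding admissible_def
proof (intro conjI ballI allI)
  show "f \<in> borel_measurable (lebesgue_on (strip \<alpha> \<beta>))"
    using f by (intro measurable_restrict_space1 measurable_completion)
      (simp add: borel_measurable_continuous_onI)
  fix y
  have line: "continuous_on S (\<lambda>x. f (Complex x y))" for S
    using continuous_on_compose2[OF f continuous_Complex_line] by auto
  show "(\<lambda>x. f (Complex x y)) \<in> borel_measurable lebesgue"
    using line by (intro measurable_completion) (simp add: borel_measurable_continuous_onI)
  show "set_integrable lebesgue {a..b} (\<lambda>x. norm (f (Complex x y)) powr p)" for a b
    by (intro absolutely_integrable_continuous_real continuous_norm_powr line p)
qed

text \<open>A bridge between the nonnegative integral, where series and integral may be interchanged
  freely, and the gauge integral in which the spike estimates are stated.\<close>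

lemma nn_integral_continuous_Icc:
  fixes h :: "real \<Rightarrow> real"
  assumes h: "continuous_on {a..b} h" and "\<And>t. 0 \<le> h t"
  shows "(\<integral>\<^sup>+t. ennreal (h t) * indicator {a..b} t \<partial>lebesgue) = ennreal (integral {a..b} h)"
proof -
  have int: "set_integrable lebesgue {a..b} h"
    using h by (rule absolutely_integrable_continuous_real)
  have "(\<integral>\<^sup>+t. ennreal (h t) * indicator {a..b} t \<partial>lebesgue)
      = (\<integral>\<^sup>+t. ennreal (indicator {a..b} t *\<^sub>R h t) \<partial>lebesgue)"
    by (intro nn_integral_cong) (auto simp: indicator_def)
  also have "\<dots> = ennreal (LINT t:{a..b}|lebesgue. h t)"
    unfolding set_lebesgue_integral_def using int assms(2)
    by (intro nn_integral_eq_integral) (auto simp: set_integrable_def)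
  also have "\<dots> = ennreal (integral {a..b} h)"
    using set_lebesgue_integral_eq_integral(2)[OF int] by simp
  finally show ?thesis .
qed

text \<open>A substitute for Minkowski's inequality that loses only the geometric weights: each
  weighted term is at most the \<open>p\<close>-th root of the right-hand side, and the weights
  \<open>(1/2)^(k+1)\<close> add up to \<open>1\<close>.\<close>

lemma powr_suminf_le:
  fixes a :: "nat \<Rightarrow> real"
  assumes a: "\<And>k. 0 \<le> a k" and p: "0 < p" and sum: "summable a"
  shows "ennreal ((\<Sum>k. a k) powr p) \<le> (\<Sum>k. ennreal ((2 ^ Suc k * a k) powr p))"
proof (cases "(\<Sum>k. ennreal ((2 ^ Suc k * a k) powr p)) = top")
  case False
  define r where "r k = (2 ^ Suc k * a k) powr p" for k
  have r: "summable r"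
    using False unfolding r_def by (intro summable_suminf_not_top) auto
  have le: "a k \<le> suminf r powr (1 / p) * (1 / 2) ^ Suc k" for k
  proof -
    have "r k \<le> suminf r"
      using sum_le_suminf[OF r, of "{k}"] by (simp add: r_def)
    then have "r k powr (1 / p) \<le> suminf r powr (1 / p)"
      using p by (intro powr_mono2) (auto simp: r_def)
    then have "2 ^ Suc k * a k \<le> suminf r powr (1 / p)"
      using p a[of k] by (simp add: r_def powr_powr)
    then show ?thesis
      by (simp add: power_divide field_simps)
  qed
  have "(\<lambda>k. suminf r powr (1 / p) * (1 / 2) ^ Suc k) sums (suminf r powr (1 / p))"
    using sums_mult[OF power_half_series, of "suminf r powr (1 / p)"] by simp
  then have "suminf a \<le> suminf r powr (1 / p)"
    by (rule sums_le[OF le summable_sums[OF sum]])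
  then have "suminf a powr p \<le> (suminf r powr (1 / p)) powr p"
    using p by (intro powr_mono2 suminf_nonneg sum a) auto
  also have "\<dots> = suminf r"
    using p suminf_nonneg[OF r] by (simp add: powr_powr r_def)
  finally have "ennreal (suminf a powr p) \<le> ennreal (suminf r)"
    by (rule ennreal_leI)
  also have "\<dots> = (\<Sum>k. ennreal (r k))"
    by (rule suminf_ennreal2[OF _ r, symmetric]) (simp add: r_def)
  finally show ?thesis by (simp add: r_def)
qed simp

section \<open>The spike series as an entire function\<close>

text \<open>The square in the exponent lets the scale outgrow \<open>(4 ^ n) powr p\<close> for
  every fixed \<open>p\<close>; a geometric scale would do so only for bounded
  \<open>p\<close>.\<close>

definition spike_scale :: "nat \<Rightarrow> nat" where
  "spike_scale n = 2 ^ n\<^sup>2"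

definition spike :: "nat \<Rightarrow> complex \<Rightarrow> complex" where
  "spike n z = 2 ^ n * sin (z / of_nat (spike_scale n)) ^ (2 * (spike_scale n)\<^sup>2)"

definition spike_series :: "complex \<Rightarrow> complex" where
  "spike_series z = (\<Sum>n. spike n z)"

lemma spike_scale_pos: "0 < spike_scale n"
  by (simp add: spike_scale_def)

lemma power_two_le_spike_scale: "2 ^ n \<le> spike_scale n"
  unfolding spike_scale_def by (intro power_increasing) (auto simp: power2_eq_square)

lemma eventually_spike_scale_ge: "\<forall>\<^sub>F n in sequentially. x \<le> real (spike_scale n)"
proof -
  obtain N :: nat where N: "x \<le> N" using real_arch_simple by blast
  have "x \<le> real (spike_scale n)" if "N \<le> n" for n
  proof -
    have "n \<le> spike_scale n"
      using power_two_le_spike_scale[of n] less_exp[of n] by linarith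
    then show ?thesis using N that by linarith
  qed
  then show ?thesis by (auto simp: eventually_sequentially)
qed

lemma norm_spike_le:
  assumes "2 * \<bar>Im z\<bar> \<le> spike_scale n"
  shows "norm (spike n z) \<le>
    2 ^ n * exp (2 * (Im z)\<^sup>2) * exp (- (spike_scale n * cos (Re z / spike_scale n))\<^sup>2)"
  unfolding spike_def
  using norm_sin_power_le[OF spike_scale_pos assms] by (simp add: norm_mult norm_power)

text \<open>Once the scale exceeds \<open>2 * norm z\<close>, the real part lies in the central
  window free of spike centres. The factor \<open>4 / q^2\<close>, with \<open>q\<close> at least
  \<open>2 ^ n\<close>, then beats the height \<open>2 ^ n\<close>.\<close>

lemma norm_spike_le_geometric:
  assumes "2 * norm z \<le> spike_scale n"
  shows "norm (spike n z) \<le> 4 * exp (2 * (norm z)\<^sup>2) * (1 / 2) ^ n"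
proof -
  have "norm (spike n z) \<le>
      2 ^ n * exp (2 * (Im z)\<^sup>2) * exp (- (spike_scale n * cos (Re z / spike_scale n))\<^sup>2)"
    using assms abs_Im_le_cmod[of z] by (intro norm_spike_le) linarith
  also have "\<dots> \<le> 2 ^ n * exp (2 * (norm z)\<^sup>2) * (4 * (1 / 4) ^ n)"
  proof (intro mult_mono)
    show "exp (2 * (Im z)\<^sup>2) \<le> exp (2 * (norm z)\<^sup>2)"
      using power_mono[OF abs_Im_le_cmod[of z], of 2] by simp
    have "exp (- (spike_scale n * cos (Re z / spike_scale n))\<^sup>2) \<le> 4 / (spike_scale n)\<^sup>2"
      using assms abs_Re_le_cmod[of z] norm_ge_zero[of z]
      by (intro exp_neg_cos_le spike_scale_pos) linarith
    also have "\<dots> \<le> 4 / (2 ^ n)\<^sup>2"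
    proof -
      have "real (2 ^ n) \<le> real (spike_scale n)"
        using power_two_le_spike_scale by (simp only: of_nat_le_iff)
      then have "(2 ^ n)\<^sup>2 \<le> (real (spike_scale n))\<^sup>2"
        by (intro power_mono) auto
      then show ?thesis
        by (simp add: frac_le)
    qed
    also have "((2::real) ^ n)\<^sup>2 = (2\<^sup>2) ^ n"
      by (simp only: power_mult[symmetric] mult.commute)
    also have "4 / (2\<^sup>2) ^ n = 4 * (1 / 4 :: real) ^ n"
      by (simp add: power_one_over)
    finally show "exp (- (spike_scale n * cos (Re z / spike_scale n))\<^sup>2) \<le> 4 * (1 / 4) ^ n" .
  qed auto
  also have "\<dots> = 4 * exp (2 * (norm z)\<^sup>2) * (2 * (1 / 4)) ^ n"
    by (simp only: power_mult_distrib) simp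
  finally show ?thesis by simp
qed

text \<open>The Weierstrass test needs the geometric bound only for large \<open>n\<close>, namely
  once the scale exceeds \<open>2 * R\<close>.\<close>

lemma uniform_limit_spike_series:
  "uniform_limit (cball 0 R) (\<lambda>n z. \<Sum>i<n. spike i z) spike_series sequentially"
  unfolding spike_series_def
proof (rule Weierstrass_m_test_ev)
  show "\<forall>\<^sub>F n in sequentially. \<forall>z\<in>cball 0 R. norm (spike n z) \<le> 4 * exp (2 * R\<^sup>2) * (1 / 2) ^ n"
    using eventually_spike_scale_ge[of "2 * R"]
  proof eventually_elim
    case (elim n)
    show ?case
    proof
      fix z :: complex assume "z \<in> cball 0 R"
      then have z: "norm z \<le> R" by simp
      then have "norm (spike n z) \<le> 4 * exp (2 * (norm z)\<^sup>2) * (1 / 2) ^ n"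
        using elim by (intro norm_spike_le_geometric) auto
      also have "\<dots> \<le> 4 * exp (2 * R\<^sup>2) * (1 / 2) ^ n"
        using z by (intro mult_right_mono mult_left_mono) (auto intro: power_mono)
      finally show "norm (spike n z) \<le> 4 * exp (2 * R\<^sup>2) * (1 / 2) ^ n" .
    qed
  qed
  show "summable (\<lambda>n. 4 * exp (2 * R\<^sup>2) * (1 / 2 :: real) ^ n)"
    by (intro summable_mult summable_geometric) auto
qed

lemma summable_norm_spike: "summable (\<lambda>n. norm (spike n z))"
proof (rule summable_comparison_test_ev)
  show "\<forall>\<^sub>F n in sequentially. norm (norm (spike n z)) \<le> 4 * exp (2 * (norm z)\<^sup>2) * (1 / 2) ^ n"
    using eventually_spike_scale_ge[of "2 * norm z"]
    by eventually_elim (simp add: norm_spike_le_geometric)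
  show "summable (\<lambda>n. 4 * exp (2 * (norm z)\<^sup>2) * (1 / 2 :: real) ^ n)"
    by (intro summable_mult summable_geometric) auto
qed

lemma spike_holomorphic: "spike n holomorphic_on S"
  unfolding spike_def using spike_scale_pos[of n] by (intro holomorphic_intros) auto

lemma spike_series_holomorphic: "spike_series holomorphic_on UNIV"
proof (rule holomorphic_uniform_sequence)
  show "(\<lambda>z. \<Sum>i<n. spike i z) holomorphic_on UNIV" for n
    by (intro holomorphic_intros spike_holomorphic)
  fix x :: complex
  have "cball x 1 \<subseteq> cball 0 (norm x + 1)"
    by (rule cball_subset_cball_iff[THEN iffD2]) (simp add: dist_norm)
  then have "uniform_limit (cball x 1) (\<lambda>n z. \<Sum>i<n. spike i z) spike_series sequentially"
    by (rule uniform_limit_on_subset[OF uniform_limit_spike_series])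
  then show "\<exists>d>0. cball x d \<subseteq> UNIV \<and>
      uniform_limit (cball x d) (\<lambda>n z. \<Sum>i<n. spike i z) spike_series sequentially"
    by (intro exI[of _ 1]) auto
qed auto

lemma spike_series_continuous: "continuous_on S spike_series"
  using holomorphic_on_imp_continuous_on[OF spike_series_holomorphic] continuous_on_subset by blast

lemma finite_exp_sum_spikes: "finite_exp_sum \<alpha> \<beta> (\<lambda>z. \<Sum>n<N. spike n z)"
  unfolding spike_def
  by (intro finite_exp_sum_sum finite_exp_sum_mult finite_exp_sum_power finite_exp_sum_const
      finite_exp_sum_sin)

section \<open>Approximation by partial sums in the Besicovitch distances\<close>

text \<open>This bounds the mean of the \<open>p\<close>-th power of a summand times its geometric
  weight, for imaginary parts up to \<open>H\<close> and large \<open>n\<close>. The factor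
  \<open>4 ^ n\<close> combines the height \<open>2 ^ n\<close> with a weight of at most
  \<open>2 * 2 ^ n\<close>, and \<open>20 / spike_scale n\<close> is the mean of the spike
  train.\<close>

definition tail_weight :: "real \<Rightarrow> real \<Rightarrow> nat \<Rightarrow> real" where
  "tail_weight p H n = (2 * 4 ^ n * exp (2 * H\<^sup>2)) powr p * (20 / spike_scale n)"

lemma tail_weight_nonneg: "0 \<le> tail_weight p H n"
  by (simp add: tail_weight_def)

text \<open>The essential factor is 2 to the power \<open>2 * n * p - n^2\<close>, which is at most
  \<open>(1 / 2) ^ n\<close> as soon as \<open>n\<close> is at least
  \<open>2 * p + 1\<close>.\<close>

lemma summable_tail_weight: "summable (tail_weight p H)"
proof (rule summable_comparison_test_ev)
  let ?C = "(2 * exp (2 * H\<^sup>2)) powr p * 20"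
  show "\<forall>\<^sub>F n in sequentially. norm (tail_weight p H n) \<le> ?C * (1 / 2) ^ n"
    using eventually_ge_at_top[of "nat \<lceil>2 * p + 1\<rceil>"]
  proof eventually_elim
    case (elim n)
    then have "2 * p + 1 \<le> n" by linarith
    then have "(2 * p + 1) * n \<le> real n * n" by (intro mult_right_mono) auto
    then have le: "2 * n * p - n\<^sup>2 \<le> - real n" by (simp add: power2_eq_square algebra_simps)
    have "(4::real) ^ n = 2 ^ (2 * n)" by (simp add: power_mult)
    also have "\<dots> = 2 powr (real (2 * n))" by (rule powr_realpow[symmetric]) simp
    finally have "(4::real) ^ n = 2 powr (2 * n)" by simp
    then have "(4 ^ n) powr p = 2 powr (2 * n * p)"
      by (simp add: powr_powr)
    moreover have "real (spike_scale n) = 2 powr (n\<^sup>2)"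
      by (simp add: spike_scale_def powr_realpow[symmetric])
    ultimately have "(4 ^ n) powr p / spike_scale n = 2 powr (2 * n * p - n\<^sup>2)"
      by (simp add: powr_diff)
    also have "\<dots> \<le> 2 powr (- real n)"
      using le by (intro powr_mono) auto
    also have "\<dots> = (1 / 2) ^ n"
      by (simp add: powr_minus powr_realpow power_one_over field_simps)
    finally have "?C * ((4 ^ n) powr p / spike_scale n) \<le> ?C * (1 / 2) ^ n"
      by (intro mult_left_mono) auto
    moreover have "norm (tail_weight p H n) = ?C * ((4 ^ n) powr p / spike_scale n)"
      by (simp add: tail_weight_def powr_mult)
    ultimately show ?case by simp
  qed
  show "summable (\<lambda>n. ?C * (1 / 2 :: real) ^ n)"
    by (intro summable_mult summable_geometric) auto
qed

lemma spike_series_minus_partial_sum_le: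
  fixes p y H :: real
  assumes p: "1 \<le> p" and yH: "\<bar>y\<bar> \<le> H" and N: "\<And>n. N \<le> n \<Longrightarrow> 2 * H \<le> spike_scale n"
  shows "ennreal (norm (spike_series (Complex t y) - (\<Sum>n<N. spike n (Complex t y))) powr p)
    \<le> (\<Sum>k. ennreal ((2 * 4 ^ (k + N) * exp (2 * H\<^sup>2)) powr p *
          exp (- (spike_scale (k + N) * cos (t / spike_scale (k + N)))\<^sup>2)))"
proof -
  let ?z = "Complex t y"
  define a where "a k = norm (spike (k + N) ?z)" for k
  have sum: "summable (\<lambda>n. spike n ?z)"
    using summable_norm_cancel[OF summable_norm_spike] .
  have suma: "summable a"
    unfolding a_def using summable_norm_spike[of ?z] by (subst summable_iff_shift)
  have "spike_series ?z - (\<Sum>n<N. spike n ?z) = (\<Sum>k. spike (k + N) ?z)"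
    unfolding spike_series_def using suminf_minus_initial_segment[OF sum, of N] by simp
  then have "norm (spike_series ?z - (\<Sum>n<N. spike n ?z)) \<le> suminf a"
    unfolding a_def using summable_norm[OF suma[unfolded a_def]] by simp
  then have "ennreal (norm (spike_series ?z - (\<Sum>n<N. spike n ?z)) powr p) \<le> ennreal (suminf a powr p)"
    using p by (intro ennreal_leI powr_mono2) auto
  also have "\<dots> \<le> (\<Sum>k. ennreal ((2 ^ Suc k * a k) powr p))"
    by (rule powr_suminf_le[OF _ _ suma]) (use p in \<open>auto simp: a_def\<close>)
  also have "\<dots> \<le> (\<Sum>k. ennreal ((2 * 4 ^ (k + N) * exp (2 * H\<^sup>2)) powr p *
          exp (- (spike_scale (k + N) * cos (t / spike_scale (k + N)))\<^sup>2)))"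
  proof (intro suminf_le ennreal_leI)
    fix k
    let ?E = "exp (- (spike_scale (k + N) * cos (t / spike_scale (k + N)))\<^sup>2)"
    have y2: "y\<^sup>2 \<le> H\<^sup>2"
      using yH by (metis abs_le_square_iff abs_ge_zero abs_of_nonneg order_trans)
    have "a k \<le> 2 ^ (k + N) * exp (2 * y\<^sup>2) * ?E"
      unfolding a_def using norm_spike_le[of ?z "k + N"] N[of "k + N"] yH by simp
    also have "\<dots> \<le> 2 ^ (k + N) * exp (2 * H\<^sup>2) * ?E"
      using y2 by (intro mult_right_mono mult_left_mono) auto
    finally have "2 ^ Suc k * a k \<le> 2 ^ Suc k * (2 ^ (k + N) * exp (2 * H\<^sup>2) * ?E)"
      by (intro mult_left_mono) auto
    also have "\<dots> = (2 ^ Suc k * 2 ^ (k + N)) * exp (2 * H\<^sup>2) * ?E"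
      by (simp only: mult.assoc)
    also have "\<dots> \<le> (2 * 4 ^ (k + N)) * exp (2 * H\<^sup>2) * ?E"
    proof (intro mult_right_mono)
      \<comment> \<open>The weight is enlarged so that the bound depends on \<open>k\<close> and
        \<open>N\<close> only through \<open>k + N\<close>. The tails for all \<open>N\<close> then
        belong to a single summable series.\<close>
      have "(2::real) ^ Suc k * 2 ^ (k + N) \<le> 2 ^ Suc (k + N) * 2 ^ (k + N)"
        by (intro mult_right_mono power_increasing) auto
      also have "\<dots> = 2 * (2 * 2) ^ (k + N)" by (simp only: power_mult_distrib power_Suc mult.assoc)
      finally show "(2::real) ^ Suc k * 2 ^ (k + N) \<le> 2 * 4 ^ (k + N)" by simp
    qed auto
    finally have "(2 ^ Suc k * a k) powr p \<le> (2 * 4 ^ (k + N) * exp (2 * H\<^sup>2) * ?E) powr p"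
      using p by (intro powr_mono2) (auto simp: a_def)
    also have "\<dots> = (2 * 4 ^ (k + N) * exp (2 * H\<^sup>2)) powr p * ?E powr p"
      by (rule powr_mult)
    also have "\<dots> \<le> (2 * 4 ^ (k + N) * exp (2 * H\<^sup>2)) powr p * ?E"
      using p powr_mono'[of 1 p ?E] by (intro mult_left_mono) auto
    finally show "(2 ^ Suc k * a k) powr p \<le> (2 * 4 ^ (k + N) * exp (2 * H\<^sup>2)) powr p * ?E" .
  qed auto
  finally show ?thesis .
qed

text \<open>The pointwise tail bound is integrated term by term as a nonnegative series. Each term
  contributes a multiple of \<open>2 * T\<close>, so the mean is bounded uniformly in
  \<open>T > 0\<close> and in the horizontal line.\<close>

lemma integral_spike_series_minus_partial_sum_le:
  fixes p y H T :: real
  assumes p: "1 \<le> p" and yH: "\<bar>y\<bar> \<le> H" and N: "\<And>n. N \<le> n \<Longrightarrow> 2 * H \<le> spike_scale n"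
    and T: "0 \<le> T"
  shows "integral {-T..T} (\<lambda>t. norm (spike_series (Complex t y) - (\<Sum>n<N. spike n (Complex t y))) powr p)
    \<le> 2 * T * (\<Sum>k. tail_weight p H (k + N))"
proof -
  define F where "F t = norm (spike_series (Complex t y) - (\<Sum>n<N. spike n (Complex t y))) powr p" for t
  define G where "G k t = (2 * 4 ^ (k + N) * exp (2 * H\<^sup>2)) powr p *
          exp (- (spike_scale (k + N) * cos (t / spike_scale (k + N)))\<^sup>2)" for k and t :: real
  have "continuous_on UNIV (\<lambda>z. spike_series z - (\<Sum>n<N. spike n z))"
    by (intro continuous_intros spike_series_continuous
        holomorphic_on_imp_continuous_on[OF spike_holomorphic])
  then have "continuous_on {-T..T} (\<lambda>t. spike_series (Complex t y) - (\<Sum>n<N. spike n (Complex t y)))"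
    by (rule continuous_on_compose2[OF _ continuous_Complex_line]) auto
  then have contF: "continuous_on {-T..T} F"
    unfolding F_def using p by (intro continuous_norm_powr) auto
  have contG: "continuous_on S (G k)" for S k
    unfolding G_def using spike_scale_pos[of "k + N"] by (intro continuous_intros) auto
  have intG: "integral {-T..T} (G k) \<le> 2 * T * tail_weight p H (k + N)" for k
  proof -
    have "integral {-T..T} (G k) = (2 * 4 ^ (k + N) * exp (2 * H\<^sup>2)) powr p *
      integral {-T..T} (\<lambda>t. exp (- (spike_scale (k + N) * cos (t / spike_scale (k + N)))\<^sup>2))"
      unfolding G_def by (rule Henstock_Kurzweil_Integration.integral_mult_right)
    also have "\<dots> \<le> (2 * 4 ^ (k + N) * exp (2 * H\<^sup>2)) powr p * (2 * T * (20 / spike_scale (k + N)))"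
      using T by (intro mult_left_mono integral_spikes_le spike_scale_pos) auto
    also have "\<dots> = 2 * T * tail_weight p H (k + N)"
      by (simp add: tail_weight_def)
    finally show ?thesis .
  qed
  have sumw: "summable (\<lambda>k. tail_weight p H (k + N))"
    using summable_tail_weight by (subst summable_iff_shift)
  have "ennreal (integral {-T..T} F) = (\<integral>\<^sup>+t. ennreal (F t) * indicator {-T..T} t \<partial>lebesgue)"
    by (rule nn_integral_continuous_Icc[symmetric, OF contF]) (simp add: F_def)
  also have "\<dots> \<le> (\<integral>\<^sup>+t. (\<Sum>k. ennreal (G k t) * indicator {-T..T} t) \<partial>lebesgue)"
  proof (rule nn_integral_mono)
    fix t
    have "ennreal (F t) \<le> (\<Sum>k. ennreal (G k t))"
      unfolding F_def G_def using p yH N by (rule spike_series_minus_partial_sum_le)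
    then show "ennreal (F t) * indicator {-T..T} t \<le> (\<Sum>k. ennreal (G k t) * indicator {-T..T} t)"
      by (cases "t \<in> {-T..T}") auto
  qed
  also have "\<dots> = (\<Sum>k. \<integral>\<^sup>+t. ennreal (G k t) * indicator {-T..T} t \<partial>lebesgue)"
  proof (rule nn_integral_suminf)
    fix k
    have "G k \<in> borel_measurable lebesgue"
      using contG by (intro measurable_completion) (simp add: borel_measurable_continuous_onI)
    then show "(\<lambda>t. ennreal (G k t) * indicator {-T..T} t) \<in> borel_measurable lebesgue"
      by (intro borel_measurable_times_ennreal borel_measurable_indicator
          measurable_compose[OF _ measurable_ennreal]) auto
  qed
  also have "\<dots> = (\<Sum>k. ennreal (integral {-T..T} (G k)))"
    by (intro suminf_cong nn_integral_continuous_Icc contG) (simp add: G_def)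
  also have "\<dots> \<le> (\<Sum>k. ennreal (2 * T * tail_weight p H (k + N)))"
    using intG by (intro suminf_le ennreal_leI) auto
  also have "\<dots> = ennreal (\<Sum>k. 2 * T * tail_weight p H (k + N))"
    using T sumw by (intro suminf_ennreal2 summable_mult) (auto simp: tail_weight_nonneg)
  also have "(\<Sum>k. 2 * T * tail_weight p H (k + N)) = 2 * T * (\<Sum>k. tail_weight p H (k + N))"
    by (rule suminf_mult[OF sumw])
  finally have "integral {-T..T} F \<le> 2 * T * (\<Sum>k. tail_weight p H (k + N))"
    using T suminf_nonneg[OF sumw] by (subst (asm) ennreal_le_iff) (auto simp: tail_weight_nonneg)
  then show ?thesis by (simp only: F_def[abs_def])
qed

lemma spike_series_in_HB_entire:
  assumes p: "1 \<le> p"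
  shows "spike_series \<in> HB_entire p"
  unfolding HB_entire_def B_space_def
proof (safe intro!: spike_series_holomorphic admissible_continuous spike_series_continuous)
  show "0 < p" using p by simp
next
  fix \<alpha> \<beta> \<epsilon> :: real assume "0 < \<epsilon>"
  define H where "H = \<bar>\<alpha>\<bar> + \<bar>\<beta>\<bar>"
  \<comment> \<open>The \<open>p\<close>-th root of \<open>\<delta>\<close> is
    \<open>\<epsilon> / 2\<close>; halving restores the strict inequality after the non-strict bound
    on the upper limit.\<close>
  define \<delta> where "\<delta> = (\<epsilon> / 2) powr p"
  have "0 < \<delta>" using \<open>0 < \<epsilon>\<close> by (simp add: \<delta>_def)
  \<comment> \<open>\<open>N0\<close> makes the pointwise spike bounds valid throughout the strip,
    and \<open>N1\<close> makes the tail of the weights smaller than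
    \<open>\<delta>\<close>.\<close>
  obtain N0 where N0: "\<And>n. N0 \<le> n \<Longrightarrow> 2 * H \<le> spike_scale n"
    using eventually_spike_scale_ge[of "2 * H"] by (auto simp: eventually_sequentially)
  obtain N1 where N1: "\<And>n. N1 \<le> n \<Longrightarrow> norm (\<Sum>k. tail_weight p H (k + n)) < \<delta>"
    using suminf_exist_split[OF \<open>0 < \<delta>\<close> summable_tail_weight] by blast
  define N where "N = max N0 N1"
  let ?Q = "\<lambda>z. \<Sum>n<N. spike n z"
  have "Besicovitch_dist p \<alpha> \<beta> spike_series ?Q \<le> ereal (\<epsilon> / 2)"
    unfolding Besicovitch_dist_def
  proof (rule Limsup_bounded)
    show "\<forall>\<^sub>F T in at_top. (SUP y\<in>{\<alpha>..\<beta>}. ereal ((1 / (2 * T) *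
         (LINT t:{-T..T}|lebesgue. norm (spike_series (Complex t y) - ?Q (Complex t y)) powr p))
           powr (1 / p))) \<le> ereal (\<epsilon> / 2)"
      using eventually_gt_at_top[of 0]
    proof eventually_elim
      case (elim T)
      show ?case
      proof (rule SUP_least)
        fix y assume "y \<in> {\<alpha>..\<beta>}"
        then have y: "\<bar>y\<bar> \<le> H" by (auto simp: H_def)
        let ?F = "\<lambda>t. norm (spike_series (Complex t y) - ?Q (Complex t y)) powr p"
        have "continuous_on UNIV (\<lambda>z. spike_series z - ?Q z)"
          by (intro continuous_intros spike_series_continuous
              holomorphic_on_imp_continuous_on[OF spike_holomorphic])
        then have "continuous_on {-T..T} (\<lambda>t. spike_series (Complex t y) - ?Q (Complex t y))"
          by (rule continuous_on_compose2[OF _ continuous_Complex_line]) auto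
        then have contF: "continuous_on {-T..T} ?F"
          using p by (intro continuous_norm_powr) auto
        then have I: "(LINT t:{-T..T}|lebesgue. ?F t) = integral {-T..T} ?F"
          by (intro set_lebesgue_integral_eq_integral absolutely_integrable_continuous_real)
        have "integral {-T..T} ?F \<le> 2 * T * (\<Sum>k. tail_weight p H (k + N))"
          using elim N0 y p by (intro integral_spike_series_minus_partial_sum_le) (auto simp: N_def)
        also have "\<dots> \<le> 2 * T * \<delta>"
          using elim N1[of N] by (intro mult_left_mono) (auto simp: N_def)
        finally have "1 / (2 * T) * integral {-T..T} ?F \<le> \<delta>"
          using elim by (simp add: field_simps)
        moreover have "0 \<le> 1 / (2 * T) * integral {-T..T} ?F"
          using elim contF
          by (intro mult_nonneg_nonneg Henstock_Kurzweil_Integration.integral_nonneg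
              integrable_continuous_real) auto
        ultimately have "(1 / (2 * T) * integral {-T..T} ?F) powr (1 / p) \<le> \<delta> powr (1 / p)"
          using p by (intro powr_mono2) auto
        also have "\<dots> = \<epsilon> / 2"
          using p \<open>0 < \<epsilon>\<close> by (simp add: \<delta>_def powr_powr)
        finally show "ereal ((1 / (2 * T) * (LINT t:{-T..T}|lebesgue. ?F t)) powr (1 / p)) \<le> ereal (\<epsilon> / 2)"
          unfolding I by simp
      qed
    qed
  qed
  also have "\<dots> < ereal \<epsilon>" using \<open>0 < \<epsilon>\<close> by simp
  finally show "\<exists>Q. finite_exp_sum \<alpha> \<beta> Q \<and> Besicovitch_dist p \<alpha> \<beta> spike_series Q < ereal \<epsilon>"
    using finite_exp_sum_spikes by blast
qed

section \<open>Lower bounds for the spike series on the real axis\<close>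

lemma Limsup_less_imp_eventually:
  fixes C :: "'b :: complete_linorder"
  assumes "Limsup F f < C"
  shows "\<forall>\<^sub>F x in F. f x < C"
proof -
  obtain P where P: "eventually P F" "(SUP x\<in>{x. P x}. f x) < C"
    using assms unfolding Limsup_def INF_less_iff by auto
  have "f x < C" if "P x" for x
    using that P(2) by (auto intro: le_less_trans[OF SUP_upper])
  then show ?thesis
    using P(1) by (rule eventually_mono[rotated])
qed

lemma spike_of_real:
  "spike n (of_real x) = of_real (2 ^ n * sin (x / spike_scale n) ^ (2 * (spike_scale n)\<^sup>2))"
  by (simp only: spike_def of_real_mult of_real_power of_real_numeral sin_of_real[symmetric]
      of_real_divide of_real_of_nat_eq)

text \<open>The even exponents make all summands nonnegative on the real axis, so nothing cancels
  and each single summand is a lower bound.\<close>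

lemma norm_spike_series_real_ge: "Re (spike n (of_real x)) \<le> norm (spike_series (of_real x))"
proof -
  let ?s = "\<lambda>k. spike k (of_real x)"
  have sum: "summable ?s"
    using summable_norm_cancel[OF summable_norm_spike] .
  have "Re (?s n) \<le> (\<Sum>k. Re (?s k))"
    using sum_le_suminf[OF summable_Re[OF sum], of "{n}"]
    by (simp add: spike_of_real)
  also have "\<dots> = Re (spike_series (of_real x))"
    unfolding spike_series_def using Re_suminf[OF sum] by simp
  also have "\<dots> \<le> norm (spike_series (of_real x))"
    by (rule complex_Re_le_cmod)
  finally show ?thesis .
qed

text \<open>Within 1/2 of a centre the squared sine is at least \<open>1 - 1 / (4 * q^2)\<close>.
  Bernoulli's inequality with exponent \<open>q^2\<close> leaves 1 - 1/4 = 3/4 of the peak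
  height.\<close>

lemma norm_spike_series_near_peak_ge:
  assumes t: "\<bar>t - (real j + 1 / 2) * (pi * spike_scale n)\<bar> \<le> 1 / 2"
  shows "3 / 4 * 2 ^ n \<le> norm (spike_series (Complex t 0))"
proof -
  define q where "q = real (spike_scale n)"
  define v where "v = (t - (real j + 1 / 2) * (pi * q)) / q"
  have q: "1 \<le> q" using spike_scale_pos[of n] by (simp add: q_def Suc_le_eq)
  have "t / q = v + (real j + 1 / 2) * pi"
    using q by (simp add: v_def field_simps)
  then have s: "(sin (t / q))\<^sup>2 = (cos v)\<^sup>2"
    by (simp only: sin_half_odd_pi_squared)
  have v: "v\<^sup>2 \<le> 1 / (4 * q\<^sup>2)"
  proof -
    have "(t - (real j + 1 / 2) * (pi * q))\<^sup>2 \<le> (1 / 2)\<^sup>2"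
      using t by (simp only: abs_le_square_iff[symmetric] q_def abs_divide abs_one abs_numeral)
    then show ?thesis
      using q by (simp add: v_def power_divide field_simps)
  qed
  have "4 * 1 \<le> 4 * q\<^sup>2"
    using q by (intro mult_left_mono one_le_power) auto
  then have small: "1 / (4 * q\<^sup>2) \<le> 1 / 4"
    by (intro frac_le; linarith)
  have "(sin v)\<^sup>2 \<le> v\<^sup>2"
    using abs_sin_x_le_abs_x[of v] by (simp add: abs_le_square_iff)
  then have "1 - 1 / (4 * q\<^sup>2) \<le> (cos v)\<^sup>2"
    using v by (simp add: cos_squared_eq)
  moreover have "0 \<le> 1 - 1 / (4 * q\<^sup>2)"
    using small by linarith
  ultimately have "(1 - 1 / (4 * q\<^sup>2)) ^ (spike_scale n)\<^sup>2 \<le> ((sin (t / q))\<^sup>2) ^ (spike_scale n)\<^sup>2"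
    unfolding s by (rule power_mono)
  moreover have "1 + real ((spike_scale n)\<^sup>2) * (- (1 / (4 * q\<^sup>2))) \<le> (1 + (- (1 / (4 * q\<^sup>2)))) ^ (spike_scale n)\<^sup>2"
    using small by (intro Bernoulli_inequality) linarith
  ultimately have "3 / 4 \<le> ((sin (t / q))\<^sup>2) ^ (spike_scale n)\<^sup>2"
    using q by (simp add: q_def)
  then have "3 / 4 * 2 ^ n \<le> Re (spike n (of_real t))"
    by (simp add: spike_of_real q_def power_mult)
  also have "\<dots> \<le> norm (spike_series (of_real t))"
    by (rule norm_spike_series_real_ge)
  finally show ?thesis by (simp add: complex_of_real_def)
qed

section \<open>Separation of the spike series from functions of the Weyl space\<close>

text \<open>In the Weyl distance the supremum over \<open>z\<close> stands inside the upper limit,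
  so one length \<open>L\<close> serves windows around all real centres. On each of them
  \<open>g\<close> differs in mean by less than 1 from an exponential sum, which is bounded on the
  real axis.\<close>

lemma Weyl_space_window_bound:
  assumes g: "g \<in> W_space 1 \<alpha> \<beta>" and "\<alpha> \<le> 0" "0 \<le> \<beta>"
  shows "\<exists>L\<ge>1. \<exists>K. \<forall>x. integral {x - L..x + L} (\<lambda>t. norm (g (Complex t 0))) \<le> K"
proof -
  obtain Q where Q: "finite_exp_sum \<alpha> \<beta> Q" "Weyl_dist 1 \<alpha> \<beta> g Q < ereal 1"
    using g unfolding W_space_def by (auto dest: spec[of _ 1])
  note line = finite_exp_sum_on_real_line[OF Q(1) assms(2,3)]
  obtain B where B: "\<And>x. norm (Q (Complex x 0)) \<le> B"
    using line(2) by blast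
  have adm: "admissible 1 \<alpha> \<beta> g" using g by (simp add: W_space_def)
  have meas_g: "(\<lambda>x::real. g (Complex x 0)) \<in> borel_measurable lebesgue"
    and int_g: "set_integrable lebesgue {a..b} (\<lambda>x. norm (g (Complex x 0)))" for a b
    using adm assms(2,3) by (auto simp: admissible_def)
  let ?d = "\<lambda>x::real. norm (g (Complex x 0) - Q (Complex x 0))"
  \<comment> \<open>Admissibility gives integrability of the norm only; measurability along the line
    turns it into integrability of \<open>g\<close> itself.\<close>
  have int_g': "set_integrable lebesgue {a..b} (\<lambda>x. g (Complex x 0))" for a b
    by (rule set_integrable_bound[OF int_g])
      (auto simp: set_borel_measurable_def intro!: borel_measurable_scaleR meas_g
        borel_measurable_indicator)
  have int_d: "set_integrable lebesgue {a..b} ?d" for a b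
    by (intro set_integrable_norm set_integral_diff int_g' absolutely_integrable_continuous_real
        continuous_on_subset[OF line(1)]) auto
  have "\<forall>\<^sub>F T in at_top. (SUP z\<in>strip \<alpha> \<beta>. ereal ((1 / (2 * T) *
         (LINT t:{-T..T}|lebesgue. norm (g (z + of_real t) - Q (z + of_real t)) powr 1)) powr (1 / 1))) < ereal 1"
    using Q(2) unfolding Weyl_dist_def by (rule Limsup_less_imp_eventually)
  then obtain T0 where T0: "\<And>T. T0 \<le> T \<Longrightarrow> (SUP z\<in>strip \<alpha> \<beta>. ereal ((1 / (2 * T) *
         (LINT t:{-T..T}|lebesgue. norm (g (z + of_real t) - Q (z + of_real t)) powr 1)) powr (1 / 1))) < ereal 1"
    by (auto simp: eventually_at_top_linorder)
  define L where "L = max 1 T0"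
  have L: "1 \<le> L" "T0 \<le> L" by (auto simp: L_def)
  have "integral {x - L..x + L} (\<lambda>t. norm (g (Complex t 0))) \<le> 2 * L + 2 * L * B" for x
  proof -
    let ?I = "LINT t:{-L..L}|lebesgue. ?d (t + x)"
    have "Complex x 0 \<in> strip \<alpha> \<beta>" using assms(2,3) by (simp add: strip_def)
    then have "ereal ((1 / (2 * L) * (LINT t:{-L..L}|lebesgue.
        norm (g (Complex x 0 + of_real t) - Q (Complex x 0 + of_real t)) powr 1)) powr (1 / 1)) < ereal 1"
      by (rule le_less_trans[OF SUP_upper T0[OF L(2)]])
    moreover have "Complex x 0 + of_real t = Complex (t + x) 0" for t
      by (simp add: complex_eq_iff)
    ultimately have "(1 / (2 * L) * ?I) powr 1 < 1" by simp
    moreover have nn: "0 \<le> ?I"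
      unfolding set_lebesgue_integral_def by (rule Bochner_Integration.integral_nonneg) auto
    ultimately have "?I \<le> 2 * L"
      using L by (simp add: field_simps)
    \<comment> \<open>The translation is carried out for the gauge integral; nonnegativity converts
      the result back to Lebesgue integrability.\<close>
    moreover have "set_integrable lebesgue {-L..L} (\<lambda>t. ?d (t + x))"
    proof (rule nonnegative_absolutely_integrable_1)
      show "(\<lambda>t. ?d (t + x)) integrable_on {-L..L}"
        using set_lebesgue_integral_eq_integral(1)[OF int_d[of "x - L" "x + L"]]
          integrable_shift_real_ivl[of ?d "x - L" "x + L" x] by simp
    qed auto
    then have "?I = integral {-L..L} (\<lambda>t. ?d (t + x))"
      by (rule set_lebesgue_integral_eq_integral(2))
    moreover have "\<dots> = integral {x - L..x + L} ?d"
      using integral_shift_real_ivl[of "x - L" x "x + L" ?d] by simp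
    ultimately have d: "integral {x - L..x + L} ?d \<le> 2 * L" by simp
    have "integral {x - L..x + L} (\<lambda>t. norm (g (Complex t 0))) \<le> integral {x - L..x + L} (\<lambda>t. ?d t + B)"
    proof (rule integral_le)
      show "(\<lambda>t. norm (g (Complex t 0))) integrable_on {x - L..x + L}"
        by (rule set_lebesgue_integral_eq_integral(1)[OF int_g])
      show "(\<lambda>t. ?d t + B) integrable_on {x - L..x + L}"
        by (intro integrable_add integrable_const_ivl set_lebesgue_integral_eq_integral(1)[OF int_d])
      fix t
      show "norm (g (Complex t 0)) \<le> ?d t + B"
        using norm_triangle_sub[of "g (Complex t 0)" "Q (Complex t 0)"] B[of t] by linarith
    qed
    also have "\<dots> = integral {x - L..x + L} ?d + 2 * L * B"
      using L by (subst Henstock_Kurzweil_Integration.integral_add)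
        (auto intro!: set_lebesgue_integral_eq_integral int_d)
    finally show ?thesis using d by linarith
  qed
  then show ?thesis using L by blast
qed

lemma integral_spike_window_ge:
  fixes L :: real
  assumes "1 \<le> L"
  shows "3 / 4 * 2 ^ n \<le> integral {(real j + 1 / 2) * (pi * spike_scale n) - L..
      (real j + 1 / 2) * (pi * spike_scale n) + L} (\<lambda>t. norm (spike_series (Complex t 0)))"
proof -
  define c where "c = (real j + 1 / 2) * (pi * spike_scale n)"
  let ?f = "\<lambda>t. norm (spike_series (Complex t 0))"
  have "continuous_on S ?f" for S
    using continuous_on_compose2[OF spike_series_continuous[of UNIV] continuous_Complex_line]
    by (intro continuous_intros) auto
  then have int: "?f integrable_on {a..b}" for a b
    by (intro integrable_continuous_real)
  have "3 / 4 * 2 ^ n = integral {c - 1 / 2..c + 1 / 2} (\<lambda>_. 3 / 4 * 2 ^ n :: real)"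
    by simp
  also have "\<dots> \<le> integral {c - 1 / 2..c + 1 / 2} ?f"
  proof (intro integral_le int norm_spike_series_near_peak_ge[where j=j])
    fix t assume "t \<in> {c - 1 / 2..c + 1 / 2}"
    then show "\<bar>t - (real j + 1 / 2) * (pi * spike_scale n)\<bar> \<le> 1 / 2"
      unfolding c_def[symmetric] by (intro abs_leI) auto
  qed auto
  also have "\<dots> \<le> integral {c - L..c + L} ?f"
    using assms by (intro integral_subset_le int) auto
  finally show ?thesis by (simp add: c_def)
qed

text \<open>Over the window around the spike in the cell, the spike series has integral at least
  \<open>3 / 4 * 2 ^ n\<close>, but \<open>g\<close> at most \<open>K\<close>. Passing from the
  difference to its \<open>p\<close>-th power costs \<open>2 * L\<close>, and \<open>n\<close> is
  large enough to leave 1.\<close>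

lemma integral_powr_diff_cell_ge:
  fixes L K p :: real
  assumes L: "1 \<le> L" "2 * L \<le> spike_scale n" and p: "1 \<le> p"
    and K: "\<And>x. integral {x - L..x + L} (\<lambda>t. norm (g (Complex t 0))) \<le> K"
    and n: "K + 2 * L + 1 \<le> 3 / 4 * 2 ^ n"
    and int_g: "\<And>a b. (\<lambda>t. norm (g (Complex t 0))) integrable_on {a..b}"
    and int_d: "\<And>a b. (\<lambda>t. norm (spike_series (Complex t 0) - g (Complex t 0)) powr p) integrable_on {a..b}"
  shows "1 \<le> integral {real j * (pi * spike_scale n)..(real j + 1) * (pi * spike_scale n)}
      (\<lambda>t. norm (spike_series (Complex t 0) - g (Complex t 0)) powr p)"
proof -
  define P where "P = pi * spike_scale n"
  define c where "c = (real j + 1 / 2) * P"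
  let ?f = "\<lambda>t. norm (spike_series (Complex t 0))" and ?g = "\<lambda>t. norm (g (Complex t 0))"
  let ?w = "\<lambda>t. norm (spike_series (Complex t 0) - g (Complex t 0)) powr p"
  have "continuous_on S ?f" for S
    using continuous_on_compose2[OF spike_series_continuous[of UNIV] continuous_Complex_line]
    by (intro continuous_intros) auto
  then have int_f: "?f integrable_on {a..b}" for a b
    by (intro integrable_continuous_real)
  \<comment> \<open>The inequality u <= 1 + u^p replaces Hoelder's inequality in passing from order
    1 to order \<open>p\<close>.\<close>
  have le: "?f t \<le> 1 + ?w t + ?g t" for t
  proof -
    let ?u = "norm (spike_series (Complex t 0) - g (Complex t 0))"
    have "?u \<le> 1 + ?u powr p"
    proof (cases "?u \<le> 1")
      case False
      then have "?u powr 1 \<le> ?u powr p" using p by (intro powr_mono) auto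
      then show ?thesis using False by simp
    qed (simp add: add_increasing2)
    then show ?thesis
      using norm_triangle_sub[of "spike_series (Complex t 0)" "g (Complex t 0)"] by linarith
  qed
  have "3 / 4 * 2 ^ n \<le> integral {c - L..c + L} ?f"
    using integral_spike_window_ge[OF L(1)] by (simp add: c_def P_def)
  also have "\<dots> \<le> integral {c - L..c + L} (\<lambda>t. 1 + ?w t + ?g t)"
    using le by (intro integral_le int_f integrable_add int_g int_d integrable_const_ivl) auto
  also have "\<dots> = 2 * L + integral {c - L..c + L} ?w + integral {c - L..c + L} ?g"
  proof -
    have one: "((\<lambda>_. 1::real) has_integral 2 * L) {c - L..c + L}"
      using has_integral_const_real[of "1::real" "c - L" "c + L"] L by simp
    show ?thesis
      by (intro integral_unique has_integral_add one integrable_integral int_d int_g)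
  qed
  also have "\<dots> \<le> 2 * L + integral {c - L..c + L} ?w + K"
    using K by simp
  finally have "1 \<le> integral {c - L..c + L} ?w" using n by linarith
  \<comment> \<open>The window is centred in the cell and its length \<open>2 * L\<close> is at most
    the scale, hence at most \<open>P\<close>.\<close>
  also have "\<dots> \<le> integral {real j * P..(real j + 1) * P} ?w"
  proof (intro integral_subset_le int_d)
    have "1 * real (spike_scale n) \<le> P"
      unfolding P_def using pi_ge_two by (intro mult_right_mono) auto
    then have "2 * L \<le> P" using L by linarith
    then show "{c - L..c + L} \<subseteq> {real j * P..(real j + 1) * P}"
      by (auto simp: c_def algebra_simps)
  qed auto
  finally show ?thesis by (simp add: P_def)
qed

text \<open>Domination by way of |a - b| <= 2 max(|a|, |b|), which gives the factor
  \<open>2 powr p\<close>.\<close>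

lemma set_integrable_norm_diff_powr:
  assumes f: "admissible p \<alpha> \<beta> f" and g: "admissible p \<alpha> \<beta> g"
    and y: "y \<in> {\<alpha>..\<beta>}" and p: "0 \<le> p"
  shows "set_integrable lebesgue {a..b} (\<lambda>t. norm (f (Complex t y) - g (Complex t y)) powr p)"
proof -
  let ?F = "\<lambda>t. f (Complex t y)" and ?G = "\<lambda>t. g (Complex t y)"
  have meas: "?F \<in> borel_measurable lebesgue" "?G \<in> borel_measurable lebesgue"
    and int: "set_integrable lebesgue {a..b} (\<lambda>t. norm (?F t) powr p)"
      "set_integrable lebesgue {a..b} (\<lambda>t. norm (?G t) powr p)"
    using f g y by (auto simp: admissible_def)
  have "set_integrable lebesgue {a..b} (\<lambda>t. 2 powr p * (norm (?F t) powr p + norm (?G t) powr p))"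
    using int by (intro set_integrable_mult_right set_integral_add) auto
  moreover have "norm (?F t - ?G t) powr p \<le> 2 powr p * (norm (?F t) powr p + norm (?G t) powr p)" for t
  proof -
    have "norm (?F t - ?G t) powr p \<le> (2 * max (norm (?F t)) (norm (?G t))) powr p"
      using norm_triangle_ineq4[of "?F t" "?G t"] p by (intro powr_mono2) auto
    also have "\<dots> = 2 powr p * max (norm (?F t)) (norm (?G t)) powr p"
      by (rule powr_mult)
    also have "\<dots> \<le> 2 powr p * (norm (?F t) powr p + norm (?G t) powr p)"
      by (intro mult_left_mono) (auto simp: max_def)
    finally show ?thesis .
  qed
  moreover have "(\<lambda>t. norm (?F t - ?G t) powr p) \<in> borel_measurable lebesgue"
    using meas by measurable
  then have "set_borel_measurable lebesgue {a..b} (\<lambda>t. norm (?F t - ?G t) powr p)"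
    unfolding set_borel_measurable_def
    by (intro borel_measurable_scaleR borel_measurable_indicator) auto
  ultimately show ?thesis
    by (elim set_integrable_bound) auto
qed

text \<open>With \<open>L\<close> and \<open>K\<close> from the window bound, a single
  \<open>n\<close> is fixed. Every cell of length \<open>P\<close> on the positive axis then
  contributes at least 1, so the means of the difference on the real axis stay away from 0 along
  multiples of \<open>P\<close>.\<close>

lemma equivalent_spike_series_not_in_HW:
  assumes H: "0 < H" and p: "1 \<le> p" and eqv: "equivalent_HB p H spike_series g"
  shows "g \<notin> HW_space 1 H"
proof
  assume "g \<in> HW_space 1 H"
  then have gW: "g \<in> W_space 1 (-H) H" by (simp add: HW_space_def)
  have admg: "admissible p (-H) H g" and dist: "Besicovitch_dist p (-H) H spike_series g = 0"
    using eqv by (auto simp: equivalent_HB_def HB_space_def B_space_def)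
  let ?w = "\<lambda>t. norm (spike_series (Complex t 0) - g (Complex t 0)) powr p"
  have set_int_w: "set_integrable lebesgue {a..b} ?w" for a b
    using H p by (intro set_integrable_norm_diff_powr[OF admissible_continuous admg]
        spike_series_continuous) auto
  note int_w = set_lebesgue_integral_eq_integral[OF set_int_w]
  have int_g: "(\<lambda>t. norm (g (Complex t 0))) integrable_on {a..b}" for a b
    using gW H by (intro set_lebesgue_integral_eq_integral) (auto simp: W_space_def admissible_def)
  obtain L K where L: "1 \<le> L"
    and K: "\<And>x. integral {x - L..x + L} (\<lambda>t. norm (g (Complex t 0))) \<le> K"
    using Weyl_space_window_bound[OF gW] H by auto
  have "\<forall>\<^sub>F n in sequentially. 2 * L \<le> spike_scale n"
    by (rule eventually_spike_scale_ge)
  moreover have "\<forall>\<^sub>F n in sequentially. K + 2 * L + 1 \<le> 3 / 4 * 2 ^ n"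
  proof -
    have "x \<le> 2 ^ n" if "nat \<lceil>x\<rceil> \<le> n" for x :: real and n
      using that of_nat_less_two_power[of n, where ?'a=real] by linarith
    from this[of "4 / 3 * (K + 2 * L + 1)"] show ?thesis
      by (intro eventually_sequentiallyI[of "nat \<lceil>4 / 3 * (K + 2 * L + 1)\<rceil>"]) fastforce
  qed
  ultimately have "\<forall>\<^sub>F n in sequentially. 2 * L \<le> spike_scale n \<and> K + 2 * L + 1 \<le> 3 / 4 * 2 ^ n"
    by (rule eventually_conj)
  then obtain n where n: "2 * L \<le> spike_scale n" "K + 2 * L + 1 \<le> 3 / 4 * 2 ^ n"
    by (auto simp: eventually_sequentially)
  define P where "P = pi * spike_scale n"
  have P: "0 < P" using spike_scale_pos[of n] by (simp add: P_def)
  have cells: "real k \<le> integral {0..real k * P} ?w" for k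
  proof -
    have "(\<Sum>j<k. 1) \<le> (\<Sum>j<k. integral {real j * P..(real j + 1) * P} ?w)"
      unfolding P_def using integral_powr_diff_cell_ge[OF L n(1) p K n(2) int_g int_w(1)]
      by (intro sum_mono)
    then show ?thesis
      using integral_cells[of ?w P k, OF int_w(1)] P by simp
  qed
  \<comment> \<open>The \<open>k\<close> cells in [0, \<open>T\<close>] with
    \<open>T = k * P\<close> give a mean over the symmetric window of at least
    \<open>k / (2 * T) = 1 / (2 * P)\<close>; \<open>\<delta>\<close> is its \<open>p\<close>-th
    root.\<close>
  define \<delta> where "\<delta> = (1 / (2 * P)) powr (1 / p)"
  have "Besicovitch_dist p (-H) H spike_series g < ereal \<delta>"
    using P by (simp add: dist \<delta>_def)
  then have "\<forall>\<^sub>F T in at_top. (SUP y\<in>{-H..H}. ereal ((1 / (2 * T) *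
         (LINT t:{-T..T}|lebesgue. norm (spike_series (Complex t y) - g (Complex t y)) powr p))
           powr (1 / p))) < ereal \<delta>"
    unfolding Besicovitch_dist_def by (rule Limsup_less_imp_eventually)
  then obtain T0 where T0: "\<And>T. T0 \<le> T \<Longrightarrow> (SUP y\<in>{-H..H}. ereal ((1 / (2 * T) *
         (LINT t:{-T..T}|lebesgue. norm (spike_series (Complex t y) - g (Complex t y)) powr p))
           powr (1 / p))) < ereal \<delta>"
    by (auto simp: eventually_at_top_linorder)
  obtain k0 :: nat where "T0 / P \<le> k0" using real_arch_simple by blast
  \<comment> \<open>The successor makes \<open>T\<close> positive even when \<open>T0\<close> is
    not.\<close>
  define k where "k = Suc k0"
  define T where "T = real k * P"
  have T: "T0 \<le> T" "0 < T"
    using \<open>T0 / P \<le> k0\<close> P by (auto simp: T_def k_def field_simps intro: add_pos_nonneg)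
  have "ereal ((1 / (2 * T) * (LINT t:{-T..T}|lebesgue. ?w t)) powr (1 / p)) < ereal \<delta>"
    using H by (intro le_less_trans[OF SUP_upper T0[OF T(1)]]) auto
  then have lt: "(1 / (2 * T) * integral {-T..T} ?w) powr (1 / p) < \<delta>"
    by (simp add: int_w(2))
  have "1 / (2 * P) = 1 / (2 * T) * k"
    using P by (simp add: T_def k_def)
  also have "\<dots> \<le> 1 / (2 * T) * integral {-T..T} ?w"
  proof (intro mult_left_mono)
    have "real k \<le> integral {0..T} ?w" using cells by (simp add: T_def)
    also have "\<dots> \<le> integral {-T..T} ?w"
      using T by (intro integral_subset_le int_w(1)) auto
    finally show "real k \<le> integral {-T..T} ?w" .
  qed (use T in auto)
  finally have "\<delta> \<le> (1 / (2 * T) * integral {-T..T} ?w) powr (1 / p)"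
    unfolding \<delta>_def using P p by (intro powr_mono2) auto
  with lt show False by simp
qed

theorem theorem3:
  shows "\<exists>f. f \<in> (\<Inter>p\<in>{1::real..}. HB_entire p) \<and>
    (\<forall>H>0. \<forall>p\<ge>1. \<forall>g. equivalent_HB p H f g \<longrightarrow> g \<notin> HW_space 1 H)"
  using spike_series_in_HB_entire equivalent_spike_series_not_in_HW
  by (intro exI[of _ spike_series]) auto

end
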